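(* Let $n,r,t$ be positive integers and $r\le P_1\le P_2\le\cdots\le P_t$ integers. Consider all $t^{\binom{n}{r}}$ ways of distributing the $r$-subsets of $V_n=\{1,\dots,n\}$ into $t$ boxes labelled $1,\dots,t$ (i.e. all maps from the set of $r$-subsets of $V_n$ to $\{1,\dots,t\}$). For $1\le i\le t$ and a $P_i$-subset $\bar A$ of $V_n$, let $A$ denote the event "all $\binom{P_i}{r}$ $r$-subsets of $\bar A$ are put in box $i$". Let $A_1,\dots,A_k$ be $k$ pairwise distinct such events, where $A_m$ is associated with box $i_m$ and the $P_{i_m}$-subset $\bar A_m$, and for $1\le\lambda_1<\cdots<\lambda_s\le k$ put $P_{i_{\lambda_1}\cdots i_{\lambda_s}}=|\bar A_{\lambda_1}\cap\cdots\cap\bar A_{\lambda_s}|$. Let $N(A_1\cap\cdots\cap A_k)$ be the number of distributions for which all of $A_1,\dots,A_k$ hold. If the tuple $(A_1,\dots,A_k)$ is distributionally compatible, then $$N(A_1\cap\cdots\cap A_k)=t^{\binom{n}{r}+\sum_{s=1}^{k}(-1)^s\sum_{1\le\lambda_1<\cdots<\lambda_s\le k}\binom{P_{i_{\lambda_1}\cdots i_{\lambda_s}}}{r}},$$ and otherwise $N(A_1\cap\cdots\cap A_k)=0$.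
   Context: The tuple $(A_1,\dots,A_k)$ is called distributionally compatible iff for every pair $1\le\mu<\nu\le k$ with $i_\mu\ne i_\nu$ one has $|\bar A_\mu\cap\bar A_\nu|\le r-1$ (i.e. two events demanding different boxes share no $r$-subset; pairs with $i_\mu=i_\nu$ impose no constraint). Binomial coefficients $\binom{P}{r}$ with $P<r$ are $0$. *)

theory Defs
  imports Complex_Main "HOL-Library.FuncSet" "HOL-Library.Ramsey"
begin

text \<open>
  \<^term>\<open>nsets A r\<close> is the set of all \<open>r\<close>-subsets of \<open>A\<close>.  Distributions are extensional
  functions, so that distinct elements of this set are distinct maps on the \<open>r\<close>-subsets.
\<close>
definition distributions :: "nat \<Rightarrow> nat \<Rightarrow> nat \<Rightarrow> (nat set \<Rightarrow> nat) set" where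
  "distributions n r t = nsets {1..n} r \<rightarrow>\<^sub>E {1..t}"

definition box_event :: "nat \<Rightarrow> nat \<Rightarrow> nat \<Rightarrow> nat \<Rightarrow> nat set \<Rightarrow> (nat set \<Rightarrow> nat) set" where
  "box_event n r t i A = {f \<in> distributions n r t. \<forall>S \<in> nsets A r. f S = i}"

text \<open>
  A tuple of \<open>k\<close> events is given by its boxes \<open>b 1, \<dots>, b k\<close> and its sets \<open>A 1, \<dots>, A k\<close>.
\<close>
definition distributionally_compatible ::
  "nat \<Rightarrow> nat \<Rightarrow> (nat \<Rightarrow> nat) \<Rightarrow> (nat \<Rightarrow> nat set) \<Rightarrow> bool" where
  "distributionally_compatible r k b A \<longleftrightarrow>
     (\<forall>\<mu> \<nu>. 1 \<le> \<mu> \<and> \<mu> < \<nu> \<and> \<nu> \<le> k \<and> b \<mu> \<noteq> b \<nu> \<longrightarrow> card (A \<mu> \<inter> A \<nu>) \<le> r - 1)"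

text \<open>
  The intersection with \<^const>\<open>distributions\<close> only matters for \<open>k = 0\<close>, where the
  intersection of no events is the whole sample space.
\<close>
definition N_events ::
  "nat \<Rightarrow> nat \<Rightarrow> nat \<Rightarrow> nat \<Rightarrow> (nat \<Rightarrow> nat) \<Rightarrow> (nat \<Rightarrow> nat set) \<Rightarrow> nat" where
  "N_events n r t k b A =
     card (distributions n r t \<inter> (\<Inter>m \<in> {1..k}. box_event n r t (b m) (A m)))"

text \<open>
  Index tuples \<open>1 \<le> \<lambda>\<^sub>1 < \<dots> < \<lambda>\<^sub>s \<le> k\<close> are represented by the \<open>s\<close>-subsets of \<open>{1..k}\<close>.
\<close>
definition exponent ::
  "nat \<Rightarrow> nat \<Rightarrow> nat \<Rightarrow> (nat \<Rightarrow> nat set) \<Rightarrow> int" where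
  "exponent n r k A =
     int (n choose r) +
     (\<Sum>s = 1..k. (- 1) ^ s * (\<Sum>L \<in> nsets {1..k} s. int (card (\<Inter>l \<in> L. A l) choose r)))"

end

theory Submission
  imports Defs
begin

text \<open>
  If the tuple is compatible, an \<open>r\<close>-subset lying in several of the sets \<open>A m\<close> is sent to the
  same box by all of them.  Hence the events prescribe the values of a distribution exactly
  on the union of the families of \<open>r\<close>-subsets of the \<open>A m\<close> and leave the other values free, and
  inclusion-exclusion counts the \<open>r\<close>-subsets outside this union.  If the tuple is not
  compatible, some \<open>r\<close>-subset would have to lie in two different boxes.
\<close>

text \<open>Inclusion-exclusion through indicators: a point lies outside the union iff the product
  of all \<open>1 - c i x\<close> is 1. Expanding this product over subsets of \<open>I\<close> and
  summing over \<open>U\<close> gives the formula. Since an empty intersection is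
  \<open>UNIV\<close>, the factor \<open>U\<close> makes the term of \<open>L = {}\<close> equal to
  \<open>card U\<close>.\<close>

lemma int_card_Diff_UN:
  fixes X :: "'i \<Rightarrow> 'a set"
  assumes "finite I" and "finite U"
  shows "int (card (U - (\<Union>i\<in>I. X i))) =
    (\<Sum>L\<in>Pow I. (- 1) ^ card L * int (card (U \<inter> (\<Inter>i\<in>L. X i))))"
proof -
  define c where "c i x = (if x \<in> X i then 1 else 0 :: int)" for i x
  have ind: "(\<Prod>i\<in>L. c i x) = (if x \<in> (\<Inter>i\<in>L. X i) then 1 else 0)" if "finite L" for L x
    using that by (induction L) (auto simp: c_def)
  \<comment> \<open>The summands stand in this order so that in the expansion by
    \<open>prod_add\<close> the constant 1 is the second family, whose products vanish from the
    formula.\<close>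
  have "(\<Prod>i\<in>I. - c i x + 1) = (if x \<in> - (\<Union>i\<in>I. X i) then 1 else 0)" for x
    using \<open>finite I\<close> by (induction I) (auto simp: c_def)
  then have "int (card (U - (\<Union>i\<in>I. X i))) = (\<Sum>x\<in>U. \<Prod>i\<in>I. - c i x + 1)"
    using \<open>finite U\<close> by (simp only: sum.If_cases Collect_mem_eq Diff_eq) simp
  also have "\<dots> = (\<Sum>x\<in>U. \<Sum>L\<in>Pow I. \<Prod>i\<in>L. - c i x)"
    by (simp only: prod_add [OF \<open>finite I\<close>] prod.neutral_const mult_1_right)
  also have "\<dots> = (\<Sum>x\<in>U. \<Sum>L\<in>Pow I. (- 1) ^ card L * (\<Prod>i\<in>L. c i x))"
    by (simp add: prod_uminus)
  also have "\<dots> = (\<Sum>L\<in>Pow I. (- 1) ^ card L * (\<Sum>x\<in>U. \<Prod>i\<in>L. c i x))"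
    by (subst sum.swap) (simp add: sum_distrib_left)
  also have "\<dots> = (\<Sum>L\<in>Pow I. (- 1) ^ card L * int (card (U \<inter> (\<Inter>i\<in>L. X i))))"
  proof (rule sum.cong)
    fix L assume "L \<in> Pow I"
    then have "finite L"
      using \<open>finite I\<close> finite_subset by auto
    then show "(- 1) ^ card L * (\<Sum>x\<in>U. \<Prod>i\<in>L. c i x) =
        (- 1) ^ card L * int (card (U \<inter> (\<Inter>i\<in>L. X i)))"
      using \<open>finite U\<close> by (simp only: ind) (simp add: sum.If_cases Int_def)
  qed simp
  finally show ?thesis .
qed

text \<open>Brings inclusion-exclusion into the shape of \<open>exponent\<close>, which groups index
  sets by size.\<close>

lemma sum_Pow_by_card:
  assumes "finite I"
  shows "(\<Sum>L\<in>Pow I. f L) = (\<Sum>s\<le>card I. \<Sum>L\<in>nsets I s. f L)"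
proof -
  have "(\<Sum>L\<in>Pow I. f L) = (\<Sum>s\<le>card I. \<Sum>L | L \<in> Pow I \<and> card L = s. f L)"
    by (rule sum.group [symmetric]) (use assms in \<open>auto intro: card_mono\<close>)
  moreover have "{L. L \<in> Pow I \<and> card L = s} = nsets I s" for s
    using assms by (auto simp: nsets_def intro: finite_subset)
  ultimately show ?thesis
    by simp
qed

lemma card_Diff_UN_nsets:
  assumes "\<And>m. m \<in> {1..k} \<Longrightarrow> A m \<subseteq> {1..n}"
  shows "int (card (nsets {1..n} r - (\<Union>m\<in>{1..k}. nsets (A m) r))) = exponent n r k A"
proof -
  define U where "U = nsets {1..n} r"
  define g where "g L = (- 1) ^ card L * int (card (U \<inter> (\<Inter>m\<in>L. nsets (A m) r)))" for L
  have g: "g L = (- 1) ^ s * int (card (\<Inter>l\<in>L. A l) choose r)"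
    if "L \<in> nsets {1..k} s" "s \<ge> 1" for L s
  proof -
    have L: "L \<subseteq> {1..k}" "L \<noteq> {}" "card L = s"
      using that by (auto simp: nsets_def)
    \<comment> \<open>An \<open>r\<close>-set lies in every \<open>A l\<close> iff it lies in their
      intersection. As \<open>L\<close> is nonempty, that intersection is contained in
      \<open>{1..n}\<close>, so intersecting with \<open>U\<close> loses nothing.\<close>
    then have "U \<inter> (\<Inter>m\<in>L. nsets (A m) r) = nsets (\<Inter>l\<in>L. A l) r"
      using assms unfolding U_def nsets_def by blast
    then show ?thesis
      using L by (simp add: g_def)
  qed
  have "int (card (U - (\<Union>m\<in>{1..k}. nsets (A m) r))) = (\<Sum>L\<in>Pow {1..k}. g L)"
    unfolding g_def U_def by (rule int_card_Diff_UN) (simp_all add: finite_imp_finite_nsets)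
  also have "\<dots> = (\<Sum>s\<le>k. \<Sum>L\<in>nsets {1..k} s. g L)"
    by (simp add: sum_Pow_by_card)
  \<comment> \<open>Size 0 is split off because \<open>g\<close> does not cover it; its only index
    set is \<open>{}\<close>, which yields the leading \<open>n choose r\<close>.\<close>
  also have "\<dots> = g {} + (\<Sum>s=1..k. \<Sum>L\<in>nsets {1..k} s. g L)"
    by (simp add: sum.atLeast1_atMost_eq sum.atMost_shift lessThan_Suc_atMost)
  also have "\<dots> = exponent n r k A"
  proof -
    have "g {} = int (n choose r)"
      by (simp add: g_def U_def)
    moreover have "(\<Sum>s=1..k. \<Sum>L\<in>nsets {1..k} s. g L) =
        (\<Sum>s=1..k. \<Sum>L\<in>nsets {1..k} s. (- 1) ^ s * int (card (\<Inter>l\<in>L. A l) choose r))"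
      by (intro sum.cong refl g) auto
    ultimately show ?thesis
      by (simp add: exponent_def sum_distrib_left)
  qed
  finally show ?thesis
    by (simp add: U_def)
qed

lemma N_events_compatible:
  assumes compat: "distributionally_compatible r k b A" and "r > 0"
    and b: "\<And>m. m \<in> {1..k} \<Longrightarrow> b m \<in> {1..t}"
    and A: "\<And>m. m \<in> {1..k} \<Longrightarrow> A m \<subseteq> {1..n}"
  shows "N_events n r t k b A = t ^ card (nsets {1..n} r - (\<Union>m\<in>{1..k}. nsets (A m) r))"
proof -
  define V where "V = nsets {1..n} r"
  define U where "U = (\<Union>m\<in>{1..k}. nsets (A m) r)"
  \<comment> \<open>\<open>F S\<close> collects the boxes open to \<open>S\<close>: those demanded
    by the events if there are any, else all of them. Compatibility will make the first kind a
    singleton.\<close>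
  define F where "F S = (if S \<in> U then b ` {m \<in> {1..k}. S \<in> nsets (A m) r} else {1..t})" for S
  have fin: "finite V"
    by (simp add: V_def finite_imp_finite_nsets)
  have UV: "U \<subseteq> V"
    using A unfolding U_def V_def nsets_def by blast
  \<comment> \<open>A common \<open>r\<close>-subset makes the intersection have at least
    \<open>r\<close> elements, which exceeds \<open>r - 1\<close> because
    \<open>r > 0\<close>.\<close>
  have less: "b \<mu> = b \<nu>"
    if "S \<in> nsets (A \<mu>) r" "S \<in> nsets (A \<nu>) r" "\<mu> \<in> {1..k}" "\<nu> \<in> {1..k}" "\<mu> < \<nu>" for S \<mu> \<nu>
  proof (rule ccontr)
    assume "b \<mu> \<noteq> b \<nu>"
    with compat that have "card (A \<mu> \<inter> A \<nu>) \<le> r - 1"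
      by (auto simp: distributionally_compatible_def)
    moreover have "finite (A \<mu> \<inter> A \<nu>)"
      using A that by (meson finite_Int finite_atLeastAtMost finite_subset)
    then have "card S \<le> card (A \<mu> \<inter> A \<nu>)"
      using that by (intro card_mono) (auto simp: nsets_def)
    ultimately show False
      using that \<open>r > 0\<close> by (auto simp: nsets_def)
  qed
  have same: "b \<mu> = b \<nu>"
    if "S \<in> nsets (A \<mu>) r" "S \<in> nsets (A \<nu>) r" "\<mu> \<in> {1..k}" "\<nu> \<in> {1..k}" for S \<mu> \<nu>
    using less that by (metis linorder_neqE_nat)
  have F: "F S = {b m}" if "m \<in> {1..k}" "S \<in> nsets (A m) r" for m S
  proof -
    have "S \<in> U"
      using that by (auto simp: U_def)
    moreover have "b ` {m \<in> {1..k}. S \<in> nsets (A m) r} = {b m}"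
      using that same by blast
    ultimately show ?thesis
      by (simp add: F_def)
  qed
  have F': "F S = {1..t}" if "S \<notin> U" for S
    using that by (simp add: F_def)
  \<comment> \<open>The events constrain each \<open>S\<close> separately, so their intersection is
    a product set and its size a product of the \<open>card (F S)\<close>.\<close>
  have "distributions n r t \<inter> (\<Inter>m\<in>{1..k}. box_event n r t (b m) (A m)) = Pi\<^sub>E V F"
  proof (intro equalityI subsetI)
    fix f assume f: "f \<in> distributions n r t \<inter> (\<Inter>m\<in>{1..k}. box_event n r t (b m) (A m))"
    then have f1: "f \<in> V \<rightarrow>\<^sub>E {1..t}" and
      f2: "\<And>m S. m \<in> {1..k} \<Longrightarrow> S \<in> nsets (A m) r \<Longrightarrow> f S = b m"
      by (auto simp: distributions_def box_event_def V_def)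
    show "f \<in> Pi\<^sub>E V F"
    proof (rule PiE_I)
      fix S assume "S \<in> V"
      show "f S \<in> F S"
      proof (cases "S \<in> U")
        case True
        then obtain m where "m \<in> {1..k}" "S \<in> nsets (A m) r"
          by (auto simp: U_def)
        then show ?thesis
          using F f2 by simp
      next
        case False
        then show ?thesis
          using F' f1 \<open>S \<in> V\<close> by (metis PiE_mem)
      qed
    qed (use f1 in auto)
  next
    fix f assume f: "f \<in> Pi\<^sub>E V F"
    have f2: "f S = b m" if "m \<in> {1..k}" "S \<in> nsets (A m) r" for m S
    proof -
      have "S \<in> V"
        using that UV unfolding U_def by blast
      then show ?thesis
        using f F that by (metis PiE_mem singletonD)
    qed
    have "f \<in> V \<rightarrow>\<^sub>E {1..t}"
    proof (rule PiE_I)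
      fix S assume "S \<in> V"
      show "f S \<in> {1..t}"
      proof (cases "S \<in> U")
        case True
        then obtain m where "m \<in> {1..k}" "S \<in> nsets (A m) r"
          by (auto simp: U_def)
        then show ?thesis
          using f2 b by metis
      next
        case False
        then show ?thesis
          using f \<open>S \<in> V\<close> F' by (metis PiE_mem)
      qed
    qed (use f in auto)
    then show "f \<in> distributions n r t \<inter> (\<Inter>m\<in>{1..k}. box_event n r t (b m) (A m))"
      using f2 by (simp add: distributions_def box_event_def V_def)
  qed
  then have "N_events n r t k b A = (\<Prod>S\<in>V. card (F S))"
    by (simp add: N_events_def card_PiE fin)
  also have "\<dots> = (\<Prod>S\<in>V. if S \<in> U then 1 else t)"
  proof (rule prod.cong)
    fix S assume "S \<in> V"
    show "card (F S) = (if S \<in> U then 1 else t)"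
    proof (cases "S \<in> U")
      case True
      then obtain m where "m \<in> {1..k}" "S \<in> nsets (A m) r"
        by (auto simp: U_def)
      then show ?thesis
        using F True by simp
    qed (simp add: F')
  qed simp
  also have "\<dots> = t ^ card (V - U)"
    by (simp add: prod.If_cases fin Diff_eq)
  finally show ?thesis
    by (simp add: U_def V_def)
qed

lemma N_events_incompatible:
  assumes "\<not> distributionally_compatible r k b A"
  shows "N_events n r t k b A = 0"
proof -
  obtain \<mu> \<nu> where "1 \<le> \<mu>" "\<mu> < \<nu>" "\<nu> \<le> k" "b \<mu> \<noteq> b \<nu>"
    and "\<not> card (A \<mu> \<inter> A \<nu>) \<le> r - 1"
    using assms unfolding distributionally_compatible_def by blast
  then have \<mu>\<nu>: "\<mu> \<in> {1..k}" "\<nu> \<in> {1..k}" "b \<mu> \<noteq> b \<nu>"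
    and "r \<le> card (A \<mu> \<inter> A \<nu>)"
    by auto
  \<comment> \<open>The two events prescribe different values at this \<open>S\<close>, so no
    distribution satisfies both.\<close>
  then obtain S where "S \<subseteq> A \<mu> \<inter> A \<nu>" "card S = r" "finite S"
    by (meson obtain_subset_with_card_n)
  then have "S \<in> nsets (A \<mu>) r" "S \<in> nsets (A \<nu>) r"
    by (auto simp: nsets_def)
  then have "box_event n r t (b \<mu>) (A \<mu>) \<inter> box_event n r t (b \<nu>) (A \<nu>) = {}"
    using \<open>b \<mu> \<noteq> b \<nu>\<close> by (auto simp: box_event_def)
  then have "distributions n r t \<inter> (\<Inter>m\<in>{1..k}. box_event n r t (b m) (A m)) = {}"
    using \<mu>\<nu> by blast
  then show ?thesis
    by (simp add: N_events_def)
qed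

theorem theorem2:
  fixes n r t k :: nat and P :: "nat \<Rightarrow> nat"
    and b :: "nat \<Rightarrow> nat" and A :: "nat \<Rightarrow> nat set"
  assumes "n > 0" and "r > 0" and "t > 0"
    and "r \<le> P 1"
    and "\<And>i j. 1 \<le> i \<Longrightarrow> i \<le> j \<Longrightarrow> j \<le> t \<Longrightarrow> P i \<le> P j"
    and "\<And>m. m \<in> {1..k} \<Longrightarrow> b m \<in> {1..t}"
    and "\<And>m. m \<in> {1..k} \<Longrightarrow> A m \<subseteq> {1..n}"
    and "\<And>m. m \<in> {1..k} \<Longrightarrow> card (A m) = P (b m)"
    and "inj_on (\<lambda>m. (b m, A m)) {1..k}"
  shows "(distributionally_compatible r k b A \<longrightarrow>
            real (N_events n r t k b A) = real t powi exponent n r k A) \<and>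
         (\<not> distributionally_compatible r k b A \<longrightarrow> N_events n r t k b A = 0)"
proof (intro conjI impI)
  assume "distributionally_compatible r k b A"
  then have "N_events n r t k b A = t ^ card (nsets {1..n} r - (\<Union>m\<in>{1..k}. nsets (A m) r))"
    using assms by (intro N_events_compatible) auto
  \<comment> \<open>The integer \<open>exponent\<close> equals a cardinality, so the integer power
    reduces to a natural one.\<close>
  then show "real (N_events n r t k b A) = real t powi exponent n r k A"
    by (simp only: card_Diff_UN_nsets [OF assms(7), symmetric] power_int_of_nat of_nat_power)
qed (rule N_events_incompatible)

end
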